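(* Let $\mathcal H=(V,E)$ be a finite hypergraph that is quasi-projective, and let $k$ be a positive integer. If $E$ contains an edge with $k$ vertices, then every nonempty subset of $V$ with at most $k$ elements is an edge of $\mathcal H$.
   Context: A hypergraph is a pair $\mathcal H=(V,E)$ with $E\subseteq\mathcal P(V)\setminus\{\emptyset\}$. A homomorphism $f:(V_1,E_1)\to(V_2,E_2)$ is a map $f:V_1\to V_2$ such that $f(e)=\{f(v):v\in e\}\in E_2$ for every $e\in E_1$; an epimorphism is a surjective homomorphism. A hypergraph $\mathcal S$ is quasi-projective if for every hypergraph $\mathcal T$, every homomorphism $f:\mathcal S\to\mathcal T$ and every epimorphism $j:\mathcal S\to\mathcal T$, there is an endomorphism $\phi$ of $\mathcal S$ with $j\circ\phi=f$. *)

theory Defs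
  imports Main "HOL-Library.FuncSet"
begin

type_synonym 'a hgraph = "'a set \<times> 'a set set"

definition hypergraph :: "'a hgraph \<Rightarrow> bool" where
  "hypergraph H \<longleftrightarrow> snd H \<subseteq> Pow (fst H) - {{}}"

text \<open>Maps between vertex sets are represented by total functions of which only the values on the
  vertex set of the source matter.\<close>

definition hg_hom :: "'a hgraph \<Rightarrow> 'b hgraph \<Rightarrow> ('a \<Rightarrow> 'b) \<Rightarrow> bool" where
  "hg_hom H K f \<longleftrightarrow> f \<in> fst H \<rightarrow> fst K \<and> (\<forall>e \<in> snd H. f ` e \<in> snd K)"

definition hg_epi :: "'a hgraph \<Rightarrow> 'b hgraph \<Rightarrow> ('a \<Rightarrow> 'b) \<Rightarrow> bool" where
  "hg_epi H K f \<longleftrightarrow> hg_hom H K f \<and> f ` fst H = fst K"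

text \<open>The targets \<open>T\<close> range over the hypergraphs whose vertices have the same type as those of \<open>S\<close>.
  This is no restriction: since \<open>j\<close> is surjective, every target is isomorphic to one with vertices
  in \<open>S\<close>; see \<open>quasi_projective_lift\<close> below, where the type of the target is arbitrary.\<close>

definition quasi_projective :: "'a hgraph \<Rightarrow> bool" where
  "quasi_projective S \<longleftrightarrow>
    (\<forall>(T :: 'a hgraph) f j. hypergraph T \<longrightarrow> hg_hom S T f \<longrightarrow> hg_epi S T j \<longrightarrow>
      (\<exists>\<phi>. hg_hom S S \<phi> \<and> (\<forall>x \<in> fst S. (j \<circ> \<phi>) x = f x)))"

lemma quasi_projective_lift:
  fixes S :: "'a hgraph" and T :: "'b hgraph"
  assumes S: "quasi_projective S" and T: "hypergraph T"
    and f: "hg_hom S T f" and j: "hg_epi S T j"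
  shows "\<exists>\<phi>. hg_hom S S \<phi> \<and> (\<forall>x \<in> fst S. (j \<circ> \<phi>) x = f x)"
proof -
  define i where "i = inv_into (fst S) j"
  define T' where "T' = (i ` fst T, (`) i ` snd T)"
  have surj: "j ` fst S = fst T"
    using j by (simp add: hg_epi_def)
  have inj: "inj_on i (fst T)"
    unfolding i_def using inj_on_inv_into[of "fst T" j "fst S"] surj by simp
  have "hypergraph T'"
    using T by (auto simp: hypergraph_def T'_def)
  moreover have "hg_hom S T' (i \<circ> f)"
    using f by (auto simp: hg_hom_def T'_def image_comp[symmetric])
  moreover have "hg_epi S T' (i \<circ> j)"
  proof -
    have "(i \<circ> j) ` fst S = fst T'"
      unfolding T'_def fst_conv surj[symmetric] image_comp ..
    moreover have "hg_hom S T' (i \<circ> j)"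
      using j by (auto simp: hg_epi_def hg_hom_def T'_def image_comp[symmetric])
    ultimately show ?thesis
      by (simp add: hg_epi_def)
  qed
  ultimately obtain \<phi> where \<phi>: "hg_hom S S \<phi>" "\<forall>x \<in> fst S. ((i \<circ> j) \<circ> \<phi>) x = (i \<circ> f) x"
    using S unfolding quasi_projective_def by blast
  have "j (\<phi> x) = f x" if x: "x \<in> fst S" for x
  proof -
    have "\<phi> x \<in> fst S" "f x \<in> fst T"
      using \<phi>(1) f x by (auto simp: hg_hom_def)
    then have "j (\<phi> x) \<in> fst T" "f x \<in> fst T"
      using surj by auto
    moreover have "i (j (\<phi> x)) = i (f x)"
      using \<phi>(2) x by simp
    ultimately show ?thesis
      using inj by (meson inj_onD)
  qed
  then show ?thesis
    using \<phi>(1) by auto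
qed

end

theory Submission
  imports Defs
begin

text \<open>Any self-map of the vertex set is a homomorphism into the complete hypergraph on the same
  vertices, and the identity is an epimorphism onto it. Lifting along the identity shows that every
  self-map is an endomorphism, and an edge with \<open>k\<close> vertices can be mapped onto any nonempty set of
  at most \<open>k\<close> vertices.\<close>

lemma quasi_projective_self_map_hom:
  assumes H: "hypergraph (V, E)" and Q: "quasi_projective (V, E)" and f: "f \<in> V \<rightarrow> V"
  shows "hg_hom (V, E) (V, E) f"
proof -
  let ?T = "(V, Pow V - {{}})"
  have edges: "e \<subseteq> V \<and> e \<noteq> {}" if "e \<in> E" for e
    using H that by (auto simp: hypergraph_def)
  have "hypergraph ?T"
    by (simp add: hypergraph_def)
  moreover have "hg_hom (V, E) ?T f"
    using f edges by (fastforce simp: hg_hom_def)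
  moreover have "hg_epi (V, E) ?T id"
    using edges by (auto simp: hg_epi_def hg_hom_def)
  ultimately obtain \<phi> where \<phi>: "hg_hom (V, E) (V, E) \<phi>" "\<forall>x \<in> V. \<phi> x = f x"
    using quasi_projective_lift[OF Q] by fastforce
  \<comment> \<open>The lift \<open>\<phi>\<close> agrees with \<open>f\<close> only on
    \<open>V\<close>, which suffices because edges lie inside \<open>V\<close>.\<close>
  have "f ` e = \<phi> ` e" if "e \<in> E" for e
    using \<phi>(2) edges[OF that] by (intro image_cong) auto
  then show ?thesis
    using \<phi>(1) f by (simp add: hg_hom_def)
qed

theorem theorem5p1:
  fixes V :: "'a set" and E :: "'a set set" and k :: nat
  assumes "hypergraph (V, E)"
    and "finite V"
    and "quasi_projective (V, E)"
    and "k > 0"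
    and "\<exists>e \<in> E. card e = k"
  shows "\<forall>A. A \<subseteq> V \<and> A \<noteq> {} \<and> card A \<le> k \<longrightarrow> A \<in> E"
proof (intro allI impI)
  fix A
  assume A: "A \<subseteq> V \<and> A \<noteq> {} \<and> card A \<le> k"
  obtain e where e: "e \<in> E" "card e = k"
    using assms(5) by blast
  have "e \<subseteq> V"
    using e(1) assms(1) by (auto simp: hypergraph_def)
  then have "finite A" "finite e"
    using A assms(2) by (auto intro: finite_subset)
  then obtain h where "h ` A \<subseteq> e" "inj_on h A"
    using card_le_inj[of A e] A e(2) by auto
  \<comment> \<open>Invert \<open>h\<close> on its image and send the rest of \<open>e\<close> to
    some point of the nonempty set \<open>A\<close>.\<close>
  then obtain g where g: "g ` e = A"
    using A inj_on_iff_surj[of A e] by blast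
  \<comment> \<open>Outside \<open>e\<close> nothing is known about \<open>g\<close>, so the
    identity is used there to keep \<open>V\<close> mapped into itself.\<close>
  define f where "f x = (if x \<in> e then g x else x)" for x
  have "f \<in> V \<rightarrow> V"
    using g A by (simp add: f_def Pi_iff) blast
  then have "f ` e \<in> E"
    using quasi_projective_self_map_hom[OF assms(1,3)] e(1) by (simp add: hg_hom_def)
  moreover have "f ` e = A"
    using g by (simp add: f_def)
  ultimately show "A \<in> E"
    by simp
qed

end
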